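(* Let $L$ be a weakly atomic completely semidistributive (complete) lattice. Then the map $\varphi:\mathrm{LM}(L)\to\mathrm{succ}(Q_L)$, $\varphi(t):=\{j\in\mathrm{JI}^c(L)\mid j\leq t\}$, is a bijection, whose inverse is given by $\psi(S)=\bigvee S$.
   Context: Lattices are complete and possibly infinite; $x\lessdot y$ denotes a cover relation. $L$ is weakly atomic if for all $x<y$ there are $u,v$ with $x\leq u\lessdot v\leq y$. $L$ is completely semidistributive if for all $x\in L$, $S\subseteq L$: if $x\vee y=x\vee z$ for all $y,z\in S$ then $x\vee\bigwedge S=x\vee y$ for all $y\in S$; and dually, if $x\wedge y=x\wedge z$ for all $y,z\in S$ then $x\wedge\bigvee S=x\wedge y$ for all $y\in S$. $\mathrm{JI}^c(L)$ is the set of completely join-irreducible elements: those $x\neq\bigvee\emptyset$ with $x\neq\bigvee S$ for every $S\subseteq\{y\mid y<x\}$; then $x_*:=\bigvee\{y\mid y<x\}$ is the unique lower cover of $x$. $\mathrm{MI}^c(L)$ (completely meet-irreducible elements) is defined dually. For $L$ as in the claim there is a bijection $\kappa:\mathrm{JI}^c(L)\to\mathrm{MI}^c(L)$, $\kappa(j)=\max\{y\in L\mid j\wedge y=j_*\}$ (the maximum exists; known fact). $\mathrm{LM}(L)$ is the set of left modular elements of $L$: those $x$ with $(y\vee x)\wedge z=y\vee(x\wedge z)$ for all $y\leq z$ in $L$. The labelling quiver $Q_L$ is the directed graph with vertex set $\mathrm{JI}^c(L)$ and, for $i,j\in\mathrm{JI}^c(L)$, an arrow $i\to j$ precisely when $i\neq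 j$ and $i\not\leq\kappa(j)$. A set $S$ of vertices of $Q_L$ is successor-closed if for every arrow $i\to j$ in $Q_L$, $i\in S$ implies $j\in S$. $\mathrm{succ}(Q_L)$ is the set of all successor-closed sets of vertices of $Q_L$. *)

theory Defs
  imports Main "Graph_Theory.Pair_Digraph"
begin

text \<open>
  A complete lattice \<open>L\<close> is a type of class \<^class>\<open>complete_lattice\<close>; properties of the whole
  lattice take the type as an argument, as in \<open>weakly_atomic TYPE('a)\<close>.
\<close>

definition covered_by :: "'a::order \<Rightarrow> 'a \<Rightarrow> bool"  (infix "\<lessdot>" 50) where
  "x \<lessdot> y \<longleftrightarrow> x < y \<and> \<not> (\<exists>z. x < z \<and> z < y)"

definition weakly_atomic :: "'a::complete_lattice itself \<Rightarrow> bool" where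
  "weakly_atomic _ \<longleftrightarrow> (\<forall>x y::'a. x < y \<longrightarrow> (\<exists>u v. x \<le> u \<and> u \<lessdot> v \<and> v \<le> y))"

definition completely_semidistributive :: "'a::complete_lattice itself \<Rightarrow> bool" where
  "completely_semidistributive _ \<longleftrightarrow>
     (\<forall>(x::'a) S. (\<forall>y\<in>S. \<forall>z\<in>S. sup x y = sup x z) \<longrightarrow> (\<forall>y\<in>S. sup x (Inf S) = sup x y)) \<and>
     (\<forall>(x::'a) S. (\<forall>y\<in>S. \<forall>z\<in>S. inf x y = inf x z) \<longrightarrow> (\<forall>y\<in>S. inf x (Sup S) = inf x y))"

definition completely_join_irreducibles :: "'a::complete_lattice set" where
  "completely_join_irreducibles = {x. x \<noteq> Sup {} \<and> (\<forall>S \<subseteq> {y. y < x}. x \<noteq> Sup S)}"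

definition lower_star :: "'a::complete_lattice \<Rightarrow> 'a" where
  "lower_star x = Sup {y. y < x}"

text \<open>
  The maximum below exists when the lattice is completely semidistributive and \<open>j\<close> is completely
  join-irreducible; otherwise the value of \<^const>\<open>Greatest\<close> may be unspecified.
\<close>

definition kappa :: "'a::complete_lattice \<Rightarrow> 'a" where
  "kappa j = (GREATEST y. inf j y = lower_star j)"

definition left_modular :: "'a::lattice \<Rightarrow> bool" where
  "left_modular x \<longleftrightarrow> (\<forall>y z. y \<le> z \<longrightarrow> inf (sup y x) z = sup y (inf x z))"

definition left_modular_elements :: "'a::lattice set" where
  "left_modular_elements = {x. left_modular x}"

definition labelling_quiver :: "'a::complete_lattice pair_pre_digraph" where
  "labelling_quiver =
     \<lparr>pverts = completely_join_irreducibles,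
      parcs = {(i, j). i \<in> completely_join_irreducibles \<and> j \<in> completely_join_irreducibles \<and>
                       i \<noteq> j \<and> \<not> i \<le> kappa j}\<rparr>"

definition successor_closed :: "'a pair_pre_digraph \<Rightarrow> 'a set \<Rightarrow> bool" where
  "successor_closed Q S \<longleftrightarrow> S \<subseteq> pverts Q \<and> (\<forall>(i, j) \<in> parcs Q. i \<in> S \<longrightarrow> j \<in> S)"

definition successor_closed_sets :: "'a pair_pre_digraph \<Rightarrow> 'a set set" where
  "successor_closed_sets Q = {S. successor_closed Q S}"

definition join_irreducibles_below :: "'a::complete_lattice \<Rightarrow> 'a set" where
  "join_irreducibles_below t = {j \<in> completely_join_irreducibles. j \<le> t}"

end

theory Submission
  imports Defs
begin

text \<open>
  Two consequences of complete semidistributivity carry the proof.  Every cover \<open>u \<lessdot> v\<close> has a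
  \<^emph>\<open>label\<close>: a completely join-irreducible \<open>j\<close> with \<open>j \<le> v\<close> and \<open>u \<le> kappa j\<close> (lemma
  \<open>cover_label\<close>).  Conversely, for completely join-irreducible \<open>j\<close>, the element
  \<open>kappa j\<close> is covered by \<open>sup (kappa j) j\<close>, and \<open>j\<close> is the least element
  whose join with \<open>kappa j\<close> gives this cover (lemmas \<open>le_sup_kappa\<close> and
  \<open>le_if_sup_kappa_eq\<close>).  Since \<open>\<not> j \<le> kappa j\<close>, the pair \<open>(j, kappa j)\<close> separates the two
  ends of each cover that \<open>j\<close> labels.

  Weak atomicity turns statements about strict inequalities into statements about covers.  Were
  some \<open>x\<close> strictly above the join of the completely join-irreducibles below it, the label of a
  cover in between would lie below that join after all; so \<open>x\<close> is recovered from the set as its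
  join.

  If \<open>t\<close> is left modular, \<open>i \<le> t\<close> and \<open>i \<rightarrow> j\<close>, then \<open>\<not> t \<le> kappa j\<close>, so \<open>sup (kappa j) t\<close> lies
  above the cover of \<open>kappa j\<close>.  Left modularity for the pair \<open>kappa j \<le> sup (kappa j) j\<close> says that
  already the part of \<open>t\<close> inside that cover generates it, and minimality of \<open>j\<close> gives \<open>j \<le> t\<close>.

  If \<open>S\<close> is successor-closed and \<open>j \<notin> S\<close>, then there is no arrow from \<open>S\<close> to \<open>j\<close>, which says exactly
  that \<open>Sup S \<le> kappa j\<close>.  Hence \<open>\<not> j \<le> Sup S\<close>, so \<open>S\<close> is recovered from its join.  A failure
  of left modularity of \<open>Sup S\<close> at \<open>y \<le> z\<close> would contain a cover whose label \<open>j\<close> lies below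
  \<open>sup y (Sup S)\<close> but not below \<open>Sup S\<close>, while both \<open>y\<close> and \<open>Sup S\<close> lie below \<open>kappa j\<close>, a
  contradiction.
\<close>

section \<open>Complete semidistributivity and completely join-irreducible elements\<close>

text \<open>
  Solutions \<open>z\<close> of \<open>sup x z = c\<close> are closed under nonempty infima, and those of \<open>inf x z = c\<close> under
  nonempty suprema; \<open>y\<close> witnesses that \<open>S\<close> is nonempty.  In this form semidistributivity yields
  least and greatest solutions.
\<close>

lemma completely_semidistributiveD:
  fixes x y :: "'a::complete_lattice"
  assumes csd: "completely_semidistributive TYPE('a)" and "y \<in> S"
  shows sup_Inf_eq: "(\<And>z. z \<in> S \<Longrightarrow> sup x z = c) \<Longrightarrow> sup x (Inf S) = c"
    and inf_Sup_eq: "(\<And>z. z \<in> S \<Longrightarrow> inf x z = c) \<Longrightarrow> inf x (Sup S) = c"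
proof -
  have "(\<forall>y\<in>S. \<forall>z\<in>S. sup x y = sup x z) \<longrightarrow> (\<forall>y\<in>S. sup x (Inf S) = sup x y)"
    and "(\<forall>y\<in>S. \<forall>z\<in>S. inf x y = inf x z) \<longrightarrow> (\<forall>y\<in>S. inf x (Sup S) = inf x y)"
    using csd unfolding completely_semidistributive_def by blast+
  then show "(\<And>z. z \<in> S \<Longrightarrow> sup x z = c) \<Longrightarrow> sup x (Inf S) = c"
    and "(\<And>z. z \<in> S \<Longrightarrow> inf x z = c) \<Longrightarrow> inf x (Sup S) = c"
    using \<open>y \<in> S\<close> by metis+
qed

lemma less_imp_le_lower_star:
  fixes x :: "'a::complete_lattice"
  shows "x < j \<Longrightarrow> x \<le> lower_star j"
  unfolding lower_star_def by (simp add: Sup_upper)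

lemma lower_star_le: "lower_star j \<le> (j::'a::complete_lattice)"
  unfolding lower_star_def by (auto intro: Sup_least)

lemma not_le_lower_star:
  fixes j :: "'a::complete_lattice"
  assumes "j \<in> completely_join_irreducibles"
  shows "\<not> j \<le> lower_star j"
proof
  assume "j \<le> lower_star j"
  then have "j = Sup {y. y < j}"
    using lower_star_le[of j] by (simp add: lower_star_def)
  then show False
    using assms by (auto simp: completely_join_irreducibles_def)
qed

lemma completely_join_irreducibleI:
  fixes j :: "'a::complete_lattice"
  assumes "\<not> j \<le> u" and "\<And>x. x < j \<Longrightarrow> x \<le> u"
  shows "j \<in> completely_join_irreducibles"
proof -
  have "j \<noteq> Sup S" if "S \<subseteq> {y. y < j}" for S
  proof -
    have "Sup S \<le> u" using that assms(2) by (auto intro: Sup_least)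
    then show ?thesis using assms(1) by auto
  qed
  then show ?thesis
    unfolding completely_join_irreducibles_def by blast
qed

section \<open>The map kappa\<close>

text \<open>
  All \<open>y\<close> with \<open>inf j y = lower_star j\<close> have the same meet with \<open>j\<close>, so by complete meet
  semidistributivity their join is one of them.  This is the existence of the maximum that defines
  \<^const>\<open>kappa\<close>; the element \<open>lower_star j\<close> shows that there is something to join.
\<close>

lemma kappa_greatest:
  fixes j :: "'a::complete_lattice"
  assumes csd: "completely_semidistributive TYPE('a)"
  shows inf_kappa: "inf j (kappa j) = lower_star j"
    and le_kappa: "inf j y = lower_star j \<Longrightarrow> y \<le> kappa j"
proof -
  let ?Y = "{y. inf j y = lower_star j}"
  have "lower_star j \<in> ?Y"
    using lower_star_le[of j] by (simp add: inf.absorb2)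
  then have max: "inf j (Sup ?Y) = lower_star j"
    by (rule inf_Sup_eq[OF csd]) simp
  have "kappa j = Sup ?Y"
    unfolding kappa_def
    by (rule Greatest_equality) (use max in \<open>auto intro: Sup_upper\<close>)
  then show "inf j (kappa j) = lower_star j"
    and "inf j y = lower_star j \<Longrightarrow> y \<le> kappa j"
    using max by (auto intro: Sup_upper)
qed

lemma lower_star_le_kappa:
  fixes j :: "'a::complete_lattice"
  assumes "completely_semidistributive TYPE('a)"
  shows "lower_star j \<le> kappa j"
  using inf_kappa[OF assms, of j] by (metis inf_le2)

lemma not_le_kappa:
  fixes j :: "'a::complete_lattice"
  assumes csd: "completely_semidistributive TYPE('a)"
    and j: "j \<in> completely_join_irreducibles"
  shows "\<not> j \<le> kappa j"
  using inf_kappa[OF csd, of j] not_le_lower_star[OF j] by (metis inf.absorb1 order_refl)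

text \<open>
  Anything strictly above \<open>kappa j\<close> meets \<open>j\<close> in more than \<open>lower_star j\<close>, by maximality of
  \<open>kappa j\<close>, hence in \<open>j\<close> itself.
\<close>

lemma le_sup_kappa:
  fixes j :: "'a::complete_lattice"
  assumes csd: "completely_semidistributive TYPE('a)" and "\<not> y \<le> kappa j"
  shows "j \<le> sup (kappa j) y"
proof (rule ccontr)
  let ?w = "sup (kappa j) y"
  assume "\<not> j \<le> ?w"
  then have "inf j ?w < j" by (metis inf_le1 inf_le2 less_le)
  then have "inf j ?w \<le> lower_star j" by (rule less_imp_le_lower_star)
  moreover have "lower_star j \<le> inf j ?w"
    using lower_star_le[of j] lower_star_le_kappa[OF csd, of j] by (simp add: le_supI1)
  ultimately have "?w \<le> kappa j" by (intro le_kappa[OF csd] antisym)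
  then show False using assms(2) by simp
qed

text \<open>
  Join semidistributivity allows \<open>x\<close> to be replaced by \<open>inf x j\<close>, and a proper lower bound of \<open>j\<close>
  is already absorbed by \<open>kappa j\<close>.
\<close>

lemma le_if_sup_kappa_eq:
  fixes j :: "'a::complete_lattice"
  assumes csd: "completely_semidistributive TYPE('a)"
    and j: "j \<in> completely_join_irreducibles"
    and eq: "sup (kappa j) x = sup (kappa j) j"
  shows "j \<le> x"
proof (rule ccontr)
  assume "\<not> j \<le> x"
  then have "inf x j < j" by (metis inf_le1 inf_le2 less_le)
  then have "inf x j \<le> kappa j"
    using less_imp_le_lower_star lower_star_le_kappa[OF csd] order_trans by blast
  moreover have "sup (kappa j) (Inf {x, j}) = sup (kappa j) j"
    by (rule sup_Inf_eq[OF csd, of x]) (use eq in auto)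
  then have "sup (kappa j) (inf x j) = sup (kappa j) j" by simp
  ultimately have "j \<le> kappa j" by (metis sup.absorb1 sup_ge2)
  then show False using not_le_kappa[OF csd j] by simp
qed

section \<open>Labels of covers\<close>

text \<open>
  The label is the least \<open>x\<close> with \<open>sup u x = v\<close>, which exists by complete join
  semidistributivity.  A smaller element no longer generates \<open>v\<close> over \<open>u\<close>, so it lies below \<open>u\<close>
  because nothing is strictly between \<open>u\<close> and \<open>v\<close>; thus \<open>u\<close> bounds everything strictly below the
  label.
\<close>

lemma cover_label:
  fixes u v :: "'a::complete_lattice"
  assumes csd: "completely_semidistributive TYPE('a)" and cover: "u \<lessdot> v"
  obtains j where "j \<in> completely_join_irreducibles" "j \<le> v" "u \<le> kappa j"
proof -
  let ?X = "{x. sup u x = v}"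
  define j where "j = Inf ?X"
  have uv: "u < v" using cover unfolding covered_by_def by simp
  have between: "w = u" if "u \<le> w" "w < v" for w
    using cover that unfolding covered_by_def by (metis le_less)
  have "v \<in> ?X" using uv by (simp add: sup.absorb2)
  then have sup_j: "sup u j = v"
    unfolding j_def by (rule sup_Inf_eq[OF csd]) simp
  then have "j \<le> v" by auto
  have not_le: "\<not> j \<le> u" using sup_j uv by (auto simp: sup.absorb1)
  have smaller: "x \<le> u" if "x < j" for x
  proof -
    have "sup u x \<noteq> v"
    proof
      assume "sup u x = v"
      then have "j \<le> x" unfolding j_def by (simp add: Inf_lower)
      then show False using that by simp
    qed
    moreover have "sup u x \<le> v" using that \<open>j \<le> v\<close> uv by (simp add: less_imp_le order.trans)
    ultimately have "sup u x = u" using between[of "sup u x"] by (simp add: less_le)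
    then show ?thesis by (metis sup_ge2)
  qed
  then have cji: "j \<in> completely_join_irreducibles"
    using not_le by (intro completely_join_irreducibleI)
  have "lower_star j \<le> u"
    unfolding lower_star_def using smaller by (auto intro: Sup_least)
  moreover have "inf j u < j" using not_le by (metis inf_le1 inf_le2 less_le)
  ultimately have "inf j u = lower_star j"
    using less_imp_le_lower_star lower_star_le by (intro antisym) auto
  then have "u \<le> kappa j" by (rule le_kappa[OF csd])
  with cji \<open>j \<le> v\<close> show thesis by (rule that)
qed

lemma less_imp_label:
  fixes x y :: "'a::complete_lattice"
  assumes "weakly_atomic TYPE('a)" and csd: "completely_semidistributive TYPE('a)" and "x < y"
  obtains j where "j \<in> completely_join_irreducibles" "j \<le> y" "x \<le> kappa j"
proof -
  obtain u v where "x \<le> u" "u \<lessdot> v" "v \<le> y"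
    using assms(1,3) unfolding weakly_atomic_def by blast
  then show thesis using cover_label[OF csd, of u v] that by (metis order_trans)
qed

text \<open>
  If the join fell short of \<open>t\<close>, a label \<open>j\<close> between the two would be one of the joined elements,
  although \<open>kappa j\<close> bounds their join.
\<close>

lemma Sup_join_irreducibles_below:
  fixes t :: "'a::complete_lattice"
  assumes wa: "weakly_atomic TYPE('a)" and csd: "completely_semidistributive TYPE('a)"
  shows "Sup (join_irreducibles_below t) = t"
proof (rule ccontr)
  assume "Sup (join_irreducibles_below t) \<noteq> t"
  moreover have "Sup (join_irreducibles_below t) \<le> t"
    by (auto simp: join_irreducibles_below_def intro: Sup_least)
  ultimately have "Sup (join_irreducibles_below t) < t" by simp
  then obtain j where j: "j \<in> completely_join_irreducibles" "j \<le> t"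
    and "Sup (join_irreducibles_below t) \<le> kappa j"
    by (rule less_imp_label[OF wa csd])
  moreover have "j \<le> Sup (join_irreducibles_below t)"
    using j by (simp add: join_irreducibles_below_def Sup_upper)
  ultimately show False using not_le_kappa[OF csd] order_trans by blast
qed

section \<open>Left modular elements and successor-closed sets\<close>

text \<open>
  The condition \<open>i \<noteq> j\<close> on arrows disappears because \<open>i \<in> S \<longrightarrow> j \<in> S\<close> is trivial for \<open>i = j\<close>.
\<close>

lemma successor_closed_labelling_quiver_iff:
  "S \<in> successor_closed_sets labelling_quiver \<longleftrightarrow>
     S \<subseteq> completely_join_irreducibles \<and>
     (\<forall>i\<in>S. \<forall>j\<in>completely_join_irreducibles. \<not> i \<le> kappa j \<longrightarrow> j \<in> S)"
  unfolding successor_closed_sets_def successor_closed_def labelling_quiver_def by auto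

text \<open>
  The modular law is applied to \<open>kappa j\<close> and its cover \<open>sup (kappa j) j\<close>: the element \<open>t\<close> reaches
  beyond \<open>kappa j\<close>, hence so does its part below the cover, and this part then contains \<open>j\<close>.
\<close>

lemma left_modular_imp_successor_closed:
  fixes t :: "'a::complete_lattice"
  assumes csd: "completely_semidistributive TYPE('a)" and lm: "left_modular t"
  shows "join_irreducibles_below t \<in> successor_closed_sets labelling_quiver"
proof -
  have "j \<le> t"
    if "i \<le> t" and j: "j \<in> completely_join_irreducibles" and "\<not> i \<le> kappa j" for i j
  proof -
    let ?m = "kappa j"
    have "\<not> t \<le> ?m" using that order_trans by blast
    then have "inf (sup ?m t) (sup ?m j) = sup ?m j"
      using le_sup_kappa[OF csd] by (simp add: inf.absorb2)
    moreover have "inf (sup ?m t) (sup ?m j) = sup ?m (inf t (sup ?m j))"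
      using lm unfolding left_modular_def by simp
    ultimately have "j \<le> inf t (sup ?m j)"
      by (intro le_if_sup_kappa_eq[OF csd j]) simp
    then show ?thesis by simp
  qed
  then show ?thesis
    unfolding successor_closed_labelling_quiver_iff join_irreducibles_below_def by blast
qed

text \<open>
  No arrow leads from \<open>S\<close> to a vertex \<open>j\<close> outside \<open>S\<close>, so \<open>kappa j\<close> bounds every element of \<open>S\<close>.
\<close>

lemma Sup_le_kappa_if_not_mem:
  assumes "S \<in> successor_closed_sets labelling_quiver"
    and "j \<in> completely_join_irreducibles" and "j \<notin> S"
  shows "Sup S \<le> kappa j"
  using assms unfolding successor_closed_labelling_quiver_iff by (blast intro: Sup_least)

lemma join_irreducibles_below_Sup:
  fixes S :: "'a::complete_lattice set"
  assumes csd: "completely_semidistributive TYPE('a)"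
    and S: "S \<in> successor_closed_sets labelling_quiver"
  shows "join_irreducibles_below (Sup S) = S"
proof
  show "S \<subseteq> join_irreducibles_below (Sup S)"
    using S unfolding successor_closed_labelling_quiver_iff join_irreducibles_below_def
    by (auto intro: Sup_upper)
  show "join_irreducibles_below (Sup S) \<subseteq> S"
    using Sup_le_kappa_if_not_mem[OF S] not_le_kappa[OF csd] order_trans
    unfolding join_irreducibles_below_def by blast
qed

text \<open>
  A label \<open>j\<close> found where the modular law fails cannot be in \<open>S\<close>, as it would then lie below both
  \<open>Sup S\<close> and \<open>z\<close>.  So \<open>kappa j\<close> bounds \<open>Sup S\<close> as well as \<open>y\<close>, and therefore \<open>j\<close>, which is
  impossible.
\<close>

lemma successor_closed_imp_left_modular_Sup:
  fixes S :: "'a::complete_lattice set"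
  assumes wa: "weakly_atomic TYPE('a)" and csd: "completely_semidistributive TYPE('a)"
    and S: "S \<in> successor_closed_sets labelling_quiver"
  shows "left_modular (Sup S)"
  unfolding left_modular_def
proof (intro allI impI, rule ccontr)
  fix y z :: 'a
  let ?t = "Sup S"
  assume "y \<le> z" and neq: "inf (sup y ?t) z \<noteq> sup y (inf ?t z)"
  \<comment> \<open>One inequality of the modular law holds in every lattice, so a failure is strict.\<close>
  have "sup y (inf ?t z) \<le> inf (sup y ?t) z"
    using \<open>y \<le> z\<close> by (simp add: le_infI1)
  with neq have "sup y (inf ?t z) < inf (sup y ?t) z" by (metis less_le)
  then obtain j where j: "j \<in> completely_join_irreducibles"
    and up: "j \<le> inf (sup y ?t) z" and down: "sup y (inf ?t z) \<le> kappa j"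
    by (rule less_imp_label[OF wa csd])
  have nle: "\<not> j \<le> kappa j" by (rule not_le_kappa[OF csd j])
  have "j \<notin> S"
  proof
    assume "j \<in> S"
    then have "j \<le> inf ?t z" using up by (simp add: Sup_upper)
    then show False using down nle by (meson le_supE order_trans)
  qed
  then have "?t \<le> kappa j" by (rule Sup_le_kappa_if_not_mem[OF S j])
  then have "sup y ?t \<le> kappa j" using down by simp
  then show False using up nle by (meson le_infE order_trans)
qed

theorem theorem1p2:
  assumes "weakly_atomic TYPE('a::complete_lattice)"
    and "completely_semidistributive TYPE('a)"
  shows "bij_betw join_irreducibles_below
           (left_modular_elements :: 'a set) (successor_closed_sets labelling_quiver) \<and>
         (\<forall>S \<in> successor_closed_sets (labelling_quiver :: 'a pair_pre_digraph).
           inv_into left_modular_elements join_irreducibles_below S = Sup S)"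
proof -
  let ?LM = "left_modular_elements :: 'a set"
  let ?succ = "successor_closed_sets (labelling_quiver :: 'a pair_pre_digraph)"
  have Sup_LM: "Sup S \<in> ?LM" if "S \<in> ?succ" for S
    using successor_closed_imp_left_modular_Sup[OF assms that]
    by (simp add: left_modular_elements_def)
  have bij: "bij_betw join_irreducibles_below ?LM ?succ"
  proof (rule bij_betw_byWitness[where f' = Sup])
    show "\<forall>t\<in>?LM. Sup (join_irreducibles_below t) = t"
      using Sup_join_irreducibles_below[OF assms] by blast
    show "\<forall>S\<in>?succ. join_irreducibles_below (Sup S) = S"
      using join_irreducibles_below_Sup[OF assms(2)] by blast
    show "join_irreducibles_below ` ?LM \<subseteq> ?succ"
      using left_modular_imp_successor_closed[OF assms(2)]
      by (auto simp: left_modular_elements_def)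
    show "Sup ` ?succ \<subseteq> ?LM" using Sup_LM by blast
  qed
  then have "inv_into ?LM join_irreducibles_below S = Sup S" if "S \<in> ?succ" for S
    using that Sup_LM join_irreducibles_below_Sup[OF assms(2) that]
    by (intro inv_into_f_eq) (auto simp: bij_betw_def)
  with bij show ?thesis by blast
qed

end
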